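(* Let $m,n\ge 2$. A matrix $A\in\mathbb{R}^{m\times n}$ preserves Chebyshev systems if and only if all rows and columns of $A$ are alternance-free. The set $\mathrm{PC}_{m,n}$ is open and dense in $\mathbb{R}^{m\times n}$. The set $\mathbb{R}^{m\times n}\setminus\mathrm{PC}_{m,n}$ is Lebesgue-null.
   Context: A vector is called Chebyshev if all of its components are non-zero; $\mathrm{Ch}_n$ is the set of Chebyshev vectors in $\mathbb{R}^n$. A vector $a\in\mathbb{R}^n$ is alternance-free if there is exactly one index $i$ such that $|a_i|=\|a\|_\infty$. For $a\in\mathbb{R}^n$ and $v\in\mathrm{Ch}_n$ (any $n\ge 2$), $\mu(a,v)$ is the unique real number with $\|a-\mu(a,v)v\|_\infty=\inf_{t\in\mathbb{R}}\|a-tv\|_\infty$ (it exists and is unique). Denote by $a^i$ the $i$-th row and by $a_j$ the $j$-th column of $A$. For $v\in\mathrm{Ch}_n$, $\phi(A,v)\in\mathbb{R}^m$ is defined by $\phi(A,v)_i=\mu(a^i,v)$; for $u\in\mathrm{Ch}_m$, $\psi(A,u)\in\mathbb{R}^n$ is defined by $\psi(A,u)_j=\mu(a_j,u)$. $A\in\mathbb{R}^{m\times n}$ preserves Chebyshev systems if $\phi(A,v)\in\mathrm{Ch}_m$ for all $v\in\mathrm{Ch}_n$ and $\psi(A,u)\in\mathrm{Ch}_n$ for all $u\in\mathrm{Ch}_m$. $\mathrm{PC}_{m,n}$ is the set of all $m\times n$ real matrices that preserve Chebyshev systems. *)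

theory Defs
  imports "HOL-Analysis.Analysis"
begin

(* Vectors in R^n are of type real^'n with n = CARD('n); an m x n matrix has type real^'n^'m, so that
   A $ i $ j is its entry in row i and column j. The uniform norm is the library's infnorm; norm on
   real^'n is the Euclidean norm. *)

definition Chebyshev :: "(real^'n) set"
  where "Chebyshev = {v. \<forall>i. v $ i \<noteq> 0}"

definition alternance_free :: "real^'n \<Rightarrow> bool"
  where "alternance_free a \<longleftrightarrow> (\<exists>!i. \<bar>a $ i\<bar> = infnorm a)"

(* The description is meaningful only for v in Chebyshev, where the minimiser exists and is unique. *)
definition best_coeff :: "real^'n \<Rightarrow> real^'n \<Rightarrow> real"
  where "best_coeff a v =
    (THE t. infnorm (a - t *\<^sub>R v) = (INF s\<in>(UNIV :: real set). infnorm (a - s *\<^sub>R v)))"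

definition phi :: "real^'n^'m \<Rightarrow> real^'n \<Rightarrow> real^'m"
  where "phi A v = (\<chi> i. best_coeff (row i A) v)"

definition psi :: "real^'n^'m \<Rightarrow> real^'m \<Rightarrow> real^'n"
  where "psi A u = (\<chi> j. best_coeff (column j A) u)"

definition preserves_Chebyshev :: "real^'n^'m \<Rightarrow> bool"
  where "preserves_Chebyshev A \<longleftrightarrow>
    (\<forall>v\<in>Chebyshev. phi A v \<in> Chebyshev) \<and> (\<forall>u\<in>Chebyshev. psi A u \<in> Chebyshev)"

definition PC :: "(real^'n^'m) set"
  where "PC = {A. preserves_Chebyshev A}"

end

theory Submission
  imports Defs
begin

text \<open>
  For a Chebyshev vector \<open>v\<close> the function \<open>t \<mapsto> infnorm (a - t *\<^sub>R v)\<close> has exactly one minimiser, so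
  \<open>best_coeff a v = 0\<close> says that \<open>a\<close> cannot be shortened by moving along \<open>v\<close>.

  In dimension at least two, if \<open>\<bar>a $ i\<bar>\<close> is maximal at a single index \<open>i\<close>, then \<open>a $ i \<noteq> 0\<close>,
  and \<open>a\<close> can be shortened along every Chebyshev \<open>v\<close>: a small step in the right
  direction decreases \<open>\<bar>a $ i\<bar>\<close> and keeps the other entries below the old maximum. If the maximum is attained at two indices, give \<open>v\<close> the sign of \<open>a\<close> at one of
  them and the opposite sign at the other; then any step along \<open>v\<close>, forwards or backwards, fails to
  decrease one of the two entries. Hence \<open>a\<close> is alternance-free iff \<open>best_coeff a v\<close> never vanishes
  (\<open>alternance_free_iff_best_coeff_nonzero\<close>). Applied to all rows and columns this is the
  characterisation of \<open>PC\<close>.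

  Being alternance-free is a finite combination of strict inequalities between absolute values of
  entries, hence an open condition. When it fails for a row or a column, the entries of the matrix at
  two different positions agree up to sign, so the complement of \<open>PC\<close> lies in a finite union of hyperplanes and is
  null. Density follows, because a nonempty open set is not null.
\<close>

section \<open>The uniform norm and the best coefficient\<close>

lemma infnorm_attained: "\<exists>i. \<bar>(a::real^'n) $ i\<bar> = infnorm a"
proof -
  have "{\<bar>a $ i\<bar> |i. i \<in> UNIV} = range (\<lambda>i. \<bar>a $ i\<bar>)"
    by auto
  then have "infnorm a = Max (range (\<lambda>i. \<bar>a $ i\<bar>))"
    unfolding infnorm_cart by (simp add: cSup_eq_Max)
  also have "\<dots> \<in> range (\<lambda>i. \<bar>a $ i\<bar>)"
    by (intro Max_in) auto
  finally show ?thesis by auto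
qed

lemma infnorm_less_iff: "infnorm (a::real^'n) < c \<longleftrightarrow> (\<forall>i. \<bar>a $ i\<bar> < c)"
proof
  show "\<forall>i. \<bar>a $ i\<bar> < c" if "infnorm a < c"
    using that component_le_infnorm_cart le_less_trans by blast
  show "infnorm a < c" if "\<forall>i. \<bar>a $ i\<bar> < c"
    using that infnorm_attained[of a] by metis
qed

lemma exists_minimiser:
  fixes a v :: "real^'n"
  assumes "v \<noteq> 0"
  shows "\<exists>t. \<forall>s. infnorm (a - t *\<^sub>R v) \<le> infnorm (a - s *\<^sub>R v)"
proof -
  define f where "f = (\<lambda>t. infnorm (a - t *\<^sub>R v))"
  have pos: "infnorm v > 0"
    using assms by (simp add: infnorm_pos_lt)
  \<comment> \<open>Beyond this radius \<open>infnorm (a - t *\<^sub>R v) \<ge> \<bar>t\<bar> * infnorm v - infnorm a\<close> exceeds the value at \<open>0\<close>.\<close>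
  define R where "R = 2 * infnorm a / infnorm v"
  have R: "0 \<le> R"
    unfolding R_def by (simp add: infnorm_pos_le)
  have "continuous_on {-R..R} f"
    unfolding f_def by (intro continuous_intros)
  with R obtain t where t: "\<And>s. s \<in> {-R..R} \<Longrightarrow> f t \<le> f s"
    using continuous_attains_inf[of "{-R..R}" f] by (auto simp del: atLeastAtMost_iff)
  have "f t \<le> f s" for s
  proof (cases "\<bar>s\<bar> \<le> R")
    case True
    then show ?thesis by (intro t) auto
  next
    case False
    have "2 * infnorm a = R * infnorm v"
      using pos by (simp add: R_def)
    also have "\<dots> \<le> \<bar>s\<bar> * infnorm v"
      using False pos by (intro mult_right_mono) auto
    also have "\<dots> = infnorm (a + - (a - s *\<^sub>R v))"
      by (simp add: infnorm_mul)
    also have "\<dots> \<le> infnorm a + f s"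
      unfolding f_def by (metis infnorm_triangle infnorm_neg)
    finally have "f 0 \<le> f s"
      by (simp add: f_def)
    moreover have "f t \<le> f 0"
      using R by (intro t) auto
    ultimately show ?thesis by simp
  qed
  then show ?thesis unfolding f_def by blast
qed

text \<open>
  At an index where the midpoint of two minimisers attains its norm, both minimisers must attain the
  minimal value with the same sign. Their entries there coincide, which is impossible when no entry of
  \<open>v\<close> vanishes.
\<close>

lemma minimiser_unique:
  fixes a v :: "real^'n"
  assumes "v \<in> Chebyshev"
    and s: "\<And>r. infnorm (a - s *\<^sub>R v) \<le> infnorm (a - r *\<^sub>R v)"
    and t: "\<And>r. infnorm (a - t *\<^sub>R v) \<le> infnorm (a - r *\<^sub>R v)"
  shows "s = t"
proof -
  define d where "d = infnorm (a - s *\<^sub>R v)"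
  have d: "infnorm (a - t *\<^sub>R v) = d"
    unfolding d_def using s t by (simp add: antisym)
  obtain i where i: "\<bar>(a - ((s + t) / 2) *\<^sub>R v) $ i\<bar> = infnorm (a - ((s + t) / 2) *\<^sub>R v)"
    using infnorm_attained by blast
  have "\<bar>(a - s *\<^sub>R v) $ i\<bar> \<le> d" "\<bar>(a - t *\<^sub>R v) $ i\<bar> \<le> d"
    using component_le_infnorm_cart[of "a - s *\<^sub>R v" i] component_le_infnorm_cart[of "a - t *\<^sub>R v" i] d
    by (simp_all add: d_def)
  moreover have "d \<le> \<bar>((a - s *\<^sub>R v) $ i + (a - t *\<^sub>R v) $ i) / 2\<bar>"
  proof -
    have "(a - ((s + t) / 2) *\<^sub>R v) $ i = ((a - s *\<^sub>R v) $ i + (a - t *\<^sub>R v) $ i) / 2"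
      by (simp add: field_simps)
    then show ?thesis
      using i s[of "(s + t) / 2"] d_def by metis
  qed
  moreover have "x = y" if "\<bar>x\<bar> \<le> d" "\<bar>y\<bar> \<le> d" "d \<le> \<bar>(x + y) / 2\<bar>" for x y :: real
  proof -
    have "2 * d \<le> \<bar>x + y\<bar>"
      using that(3) by simp
    with that(1,2) show ?thesis by linarith
  qed
  ultimately have "(a - s *\<^sub>R v) $ i = (a - t *\<^sub>R v) $ i"
    by blast
  then have "s * v $ i = t * v $ i" by simp
  then show ?thesis
    using assms(1) by (simp add: Chebyshev_def)
qed

lemma best_coeff_eq_iff:
  fixes a v :: "real^'n"
  assumes "v \<in> Chebyshev"
  shows "best_coeff a v = t \<longleftrightarrow> (\<forall>s. infnorm (a - t *\<^sub>R v) \<le> infnorm (a - s *\<^sub>R v))"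
proof -
  have inf_iff: "infnorm (a - r *\<^sub>R v) = (INF s. infnorm (a - s *\<^sub>R v)) \<longleftrightarrow>
      (\<forall>s. infnorm (a - r *\<^sub>R v) \<le> infnorm (a - s *\<^sub>R v))" for r
  proof
    have "bdd_below (range (\<lambda>s. infnorm (a - s *\<^sub>R v)))"
      by (rule bdd_belowI[of _ 0]) (auto simp: infnorm_pos_le)
    then show "\<forall>s. infnorm (a - r *\<^sub>R v) \<le> infnorm (a - s *\<^sub>R v)"
      if "infnorm (a - r *\<^sub>R v) = (INF s. infnorm (a - s *\<^sub>R v))"
      unfolding that by (auto intro: cINF_lower)
    show "infnorm (a - r *\<^sub>R v) = (INF s. infnorm (a - s *\<^sub>R v))"
      if "\<forall>s. infnorm (a - r *\<^sub>R v) \<le> infnorm (a - s *\<^sub>R v)"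
      using that by (intro cInf_eq_minimum[symmetric]) auto
  qed
  have "v \<noteq> 0"
    using assms by (auto simp: Chebyshev_def)
  then obtain t0 where t0: "\<forall>s. infnorm (a - t0 *\<^sub>R v) \<le> infnorm (a - s *\<^sub>R v)"
    using exists_minimiser by blast
  have "best_coeff a v = t0"
    unfolding best_coeff_def inf_iff
    using t0 minimiser_unique[OF assms] by (intro the_equality) blast+
  then show ?thesis
    using t0 minimiser_unique[OF assms] by blast
qed

section \<open>Alternance-free vectors\<close>

lemma alternance_free_iff_strict_max:
  "alternance_free (a::real^'n) \<longleftrightarrow> (\<exists>i. \<forall>j\<in>-{i}. \<bar>a $ j\<bar> < \<bar>a $ i\<bar>)"
proof
  assume "alternance_free a"
  then obtain i where "\<bar>a $ i\<bar> = infnorm a" "\<And>j. \<bar>a $ j\<bar> = infnorm a \<Longrightarrow> j = i"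
    unfolding alternance_free_def by blast
  then have "\<forall>j\<in>-{i}. \<bar>a $ j\<bar> < \<bar>a $ i\<bar>"
    using component_le_infnorm_cart[of a] by (metis Compl_iff less_le singletonI)
  then show "\<exists>i. \<forall>j\<in>-{i}. \<bar>a $ j\<bar> < \<bar>a $ i\<bar>" ..
next
  assume "\<exists>i. \<forall>j\<in>-{i}. \<bar>a $ j\<bar> < \<bar>a $ i\<bar>"
  then obtain i where i: "\<And>j. j \<noteq> i \<Longrightarrow> \<bar>a $ j\<bar> < \<bar>a $ i\<bar>"
    by auto
  have "j = i" if "\<bar>a $ j\<bar> = infnorm a" for j
    using i[of j] that component_le_infnorm_cart[of a i] by fastforce
  then show "alternance_free a"
    unfolding alternance_free_def using infnorm_attained[of a] by blast
qed

lemma not_alternance_free: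
  assumes "\<not> alternance_free (a::real^'n)"
  obtains i j where "i \<noteq> j" "\<bar>a $ i\<bar> = infnorm a" "\<bar>a $ j\<bar> = infnorm a"
  using assms infnorm_attained[of a] unfolding alternance_free_def by blast

lemma alternance_free_shortened:
  fixes a v :: "real^'n"
  assumes "CARD('n) \<ge> 2" "alternance_free a" "v \<in> Chebyshev"
  shows "\<exists>t. infnorm (a - t *\<^sub>R v) < infnorm a"
proof -
  obtain i where i: "\<bar>a $ i\<bar> = infnorm a" and lt: "\<And>j. j \<noteq> i \<Longrightarrow> \<bar>a $ j\<bar> < infnorm a"
    using assms(2) component_le_infnorm_cart[of a] unfolding alternance_free_def
    by (metis less_le)
  \<comment> \<open>A second index, with a strictly smaller entry, is what excludes \<open>a $ i = 0\<close>.\<close>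
  obtain j where "j \<noteq> i"
    using assms(1) card_le_Suc0_iff_eq[OF finite[of "UNIV :: 'n set"]]
    by (metis One_nat_def Suc_1 not_less_eq_eq)
  then have ai: "a $ i \<noteq> 0"
    using lt[of j] i by auto
  have vi: "v $ i \<noteq> 0"
    using assms(3) by (simp add: Chebyshev_def)
  \<comment> \<open>Along \<open>t = e * r\<close> the entry at \<open>i\<close> becomes \<open>(1 - e) * a $ i\<close>.\<close>
  define r where "r = a $ i / v $ i"
  have "\<forall>\<^sub>F e in at_right 0. \<bar>(a - (e * r) *\<^sub>R v) $ k\<bar> < infnorm a" for k
  proof (cases "k = i")
    case True
    have "\<forall>\<^sub>F e in at_right (0::real). e \<in> {0<..<1}"
      by (rule eventually_at_right_real) simp
    then show ?thesis
    proof eventually_elim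
      case (elim e)
      have "(a - (e * r) *\<^sub>R v) $ k = (1 - e) * a $ i"
        using vi True by (simp add: r_def algebra_simps)
      then show ?case
        using elim ai i[symmetric] by (simp add: abs_mult)
    qed
  next
    case False
    have "((\<lambda>e. \<bar>(a - (e * r) *\<^sub>R v) $ k\<bar>) \<longlongrightarrow> \<bar>(a - (0 * r) *\<^sub>R v) $ k\<bar>) (at_right 0)"
      by (intro tendsto_intros)
    then show ?thesis
      using lt[OF False] by (intro order_tendstoD(2)) auto
  qed
  then have "\<forall>\<^sub>F e in at_right 0. infnorm (a - (e * r) *\<^sub>R v) < infnorm a"
    unfolding infnorm_less_iff by (rule eventually_all_finite)
  then show ?thesis
    using eventually_happens'[OF trivial_limit_at_right_real] by blast
qed

text \<open>
  The vector \<open>v\<close> agrees in sign with \<open>a\<close> at one maximal index and disagrees at another, so steps with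
  \<open>t \<ge> 0\<close> are blocked by the second index and steps with \<open>t \<le> 0\<close> by the first.
\<close>

lemma not_alternance_free_not_shortened:
  fixes a :: "real^'n"
  assumes "\<not> alternance_free a"
  shows "\<exists>v\<in>Chebyshev. \<forall>t. infnorm a \<le> infnorm (a - t *\<^sub>R v)"
proof -
  obtain i j where ij: "i \<noteq> j" "\<bar>a $ i\<bar> = infnorm a" "\<bar>a $ j\<bar> = infnorm a"
    using assms by (rule not_alternance_free)
  define v :: "real^'n" where
    "v = (\<chi> k. if k = i then (if a $ i \<ge> 0 then 1 else -1)
               else if k = j then (if a $ j \<ge> 0 then -1 else 1) else 1)"
  have "infnorm a \<le> infnorm (a - t *\<^sub>R v)" for t
  proof (cases "t \<ge> 0")
    case True
    then have "\<bar>a $ j\<bar> \<le> \<bar>(a - t *\<^sub>R v) $ j\<bar>"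
      using ij(1) by (simp add: v_def)
    then show ?thesis
      using component_le_infnorm_cart[of "a - t *\<^sub>R v" j] ij(3) by linarith
  next
    case False
    then have "\<bar>a $ i\<bar> \<le> \<bar>(a - t *\<^sub>R v) $ i\<bar>"
      by (simp add: v_def)
    then show ?thesis
      using component_le_infnorm_cart[of "a - t *\<^sub>R v" i] ij(2) by linarith
  qed
  moreover have "v \<in> Chebyshev"
    by (simp add: Chebyshev_def v_def)
  ultimately show ?thesis by blast
qed

theorem alternance_free_iff_best_coeff_nonzero:
  fixes a :: "real^'n"
  assumes "CARD('n) \<ge> 2"
  shows "alternance_free a \<longleftrightarrow> (\<forall>v\<in>Chebyshev. best_coeff a v \<noteq> 0)"
proof -
  have "best_coeff a v = 0 \<longleftrightarrow> (\<forall>t. infnorm a \<le> infnorm (a - t *\<^sub>R v))"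
    if "v \<in> Chebyshev" for v
    using best_coeff_eq_iff[OF that, of a 0] by simp
  then show ?thesis
    using alternance_free_shortened[OF assms, of a] not_alternance_free_not_shortened[of a]
    by (metis not_less)
qed

section \<open>Matrices that preserve Chebyshev systems\<close>

theorem preserves_Chebyshev_iff_alternance_free:
  fixes A :: "real^'n^'m"
  assumes "CARD('m::finite) \<ge> 2" and "CARD('n::finite) \<ge> 2"
  shows "preserves_Chebyshev A \<longleftrightarrow>
    (\<forall>i. alternance_free (row i A)) \<and> (\<forall>j. alternance_free (column j A))"
proof -
  have "phi A v \<in> Chebyshev \<longleftrightarrow> (\<forall>i. best_coeff (row i A) v \<noteq> 0)" for v
    by (simp add: Chebyshev_def phi_def)
  moreover have "psi A u \<in> Chebyshev \<longleftrightarrow> (\<forall>j. best_coeff (column j A) u \<noteq> 0)" for u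
    by (simp add: Chebyshev_def psi_def)
  ultimately show ?thesis
    unfolding alternance_free_iff_best_coeff_nonzero[OF assms(1)]
      alternance_free_iff_best_coeff_nonzero[OF assms(2)] preserves_Chebyshev_def
    by blast
qed

text \<open>
  Without the norm, membership in \<open>PC\<close> is visibly a finite combination of strict inequalities between
  continuous functions of the matrix.
\<close>

lemma PC_iff_strict_max:
  assumes "CARD('m::finite) \<ge> 2" and "CARD('n::finite) \<ge> 2"
  shows "(A :: real^'n^'m) \<in> PC \<longleftrightarrow>
    (\<forall>i. \<exists>j. \<forall>k\<in>-{j}. \<bar>A $ i $ k\<bar> < \<bar>A $ i $ j\<bar>) \<and>
    (\<forall>j. \<exists>i. \<forall>k\<in>-{i}. \<bar>A $ k $ j\<bar> < \<bar>A $ i $ j\<bar>)"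
  unfolding PC_def mem_Collect_eq preserves_Chebyshev_iff_alternance_free[OF assms]
    alternance_free_iff_strict_max
  by (simp add: row_def column_def)

lemma open_PC:
  assumes "CARD('m::finite) \<ge> 2" and "CARD('n::finite) \<ge> 2"
  shows "open (PC :: (real^'n^'m) set)"
proof -
  have less: "open {A :: real^'n^'m. \<bar>A $ i $ j\<bar> < \<bar>A $ k $ l\<bar>}" for i j k l
    by (intro open_Collect_less continuous_intros)
  have "(PC :: (real^'n^'m) set) =
     (\<Inter>i. \<Union>j. \<Inter>k\<in>-{j}. {A. \<bar>A $ i $ k\<bar> < \<bar>A $ i $ j\<bar>}) \<inter>
     (\<Inter>j. \<Union>i. \<Inter>k\<in>-{i}. {A. \<bar>A $ k $ j\<bar> < \<bar>A $ i $ j\<bar>})"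
    unfolding set_eq_iff Int_iff INT_iff UN_iff mem_Collect_eq PC_iff_strict_max[OF assms] by simp
  also have "open \<dots>"
    by (intro open_Int open_INT open_UN ballI finite less)
  finally show ?thesis .
qed

lemma negligible_abs_entries_eq:
  assumes "(i, j) \<noteq> (k, l)"
  shows "negligible {A :: real^'n^'m. \<bar>A $ i $ j\<bar> = \<bar>A $ k $ l\<bar>}"
proof -
  define E :: "'m \<Rightarrow> 'n \<Rightarrow> real^'n^'m" where "E = (\<lambda>i j. axis i (axis j 1))"
  have E: "E p q \<bullet> A = A $ p $ q" for p q A
    by (simp add: E_def inner_axis' inner_axis)
  \<comment> \<open>The inner product of the normal vector with \<open>E i j\<close> is \<open>1\<close>, so this is a proper hyperplane.\<close>
  have "negligible {A. (E i j - c *\<^sub>R E k l) \<bullet> A = 0}" for c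
  proof (rule negligible_hyperplane)
    have "E i j $ i $ j = 1" "E i j $ k $ l = 0"
      using assms by (auto simp: E_def axis_def)
    then have "(E i j - c *\<^sub>R E k l) \<bullet> E i j = 1"
      by (simp add: inner_diff_left E)
    then show "E i j - c *\<^sub>R E k l \<noteq> 0 \<or> (0::real) \<noteq> 0" by fastforce
  qed
  \<comment> \<open>Equal absolute values mean equal or opposite entries, hence \<open>c = 1\<close> and \<open>c = -1\<close>.\<close>
  then have "negligible ({A. (E i j - 1 *\<^sub>R E k l) \<bullet> A = 0} \<union> {A. (E i j - (-1) *\<^sub>R E k l) \<bullet> A = 0})"
    by (intro negligible_Un)
  then show ?thesis
    by (rule negligible_subset) (auto simp: inner_diff_left E abs_eq_iff inner_add_left)
qed

lemma negligible_Compl_PC: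
  assumes "CARD('m::finite) \<ge> 2" and "CARD('n::finite) \<ge> 2"
  shows "negligible (- (PC :: (real^'n^'m) set))"
proof -
  define N :: "('m \<times> 'n) \<times> ('m \<times> 'n) \<Rightarrow> (real^'n^'m) set"
    where "N = (\<lambda>((i, j), (k, l)). {A. \<bar>A $ i $ j\<bar> = \<bar>A $ k $ l\<bar>})"
  have "negligible (\<Union>z\<in>{(p, q). p \<noteq> q}. N z)"
    by (rule negligible_Union) (auto simp: N_def intro!: negligible_abs_entries_eq)
  moreover have "- PC \<subseteq> (\<Union>z\<in>{(p, q). p \<noteq> q}. N z)"
  proof
    fix A :: "real^'n^'m"
    assume "A \<in> - PC"
    then consider (r) i where "\<not> alternance_free (row i A)"
      | (c) j where "\<not> alternance_free (column j A)"
      unfolding PC_def using preserves_Chebyshev_iff_alternance_free[OF assms, of A] by auto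
    then show "A \<in> (\<Union>z\<in>{(p, q). p \<noteq> q}. N z)"
    proof cases
      case r
      then obtain j l where "j \<noteq> l" "\<bar>row i A $ j\<bar> = \<bar>row i A $ l\<bar>"
        using not_alternance_free[of "row i A"] by metis
      then have "((i, j), (i, l)) \<in> {(p, q). p \<noteq> q}" "A \<in> N ((i, j), (i, l))"
        by (auto simp: N_def row_def)
      then show ?thesis by (rule UN_I)
    next
      case c
      then obtain i k where "i \<noteq> k" "\<bar>column j A $ i\<bar> = \<bar>column j A $ k\<bar>"
        using not_alternance_free[of "column j A"] by metis
      then have "((i, j), (k, j)) \<in> {(p, q). p \<noteq> q}" "A \<in> N ((i, j), (k, j))"
        by (auto simp: N_def column_def)
      then show ?thesis by (rule UN_I)
    qed
  qed
  ultimately show ?thesis by (rule negligible_subset)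
qed

lemma closure_eq_UNIV_if_negligible_Compl:
  fixes S :: "'a::euclidean_space set"
  assumes "negligible (- S)"
  shows "closure S = UNIV"
proof -
  have "interior (- S) = {}"
    using negligible_subset[OF assms interior_subset] open_not_negligible[OF open_interior] by blast
  then show ?thesis by (simp add: closure_interior)
qed

theorem lemma3p2:
  assumes "CARD('m::finite) \<ge> 2" and "CARD('n::finite) \<ge> 2"
  shows "(\<forall>A :: real^'n^'m. preserves_Chebyshev A \<longleftrightarrow>
            (\<forall>i. alternance_free (row i A)) \<and> (\<forall>j. alternance_free (column j A)))
       \<and> open (PC :: (real^'n^'m) set)
       \<and> closure (PC :: (real^'n^'m) set) = UNIV
       \<and> UNIV - (PC :: (real^'n^'m) set) \<in> null_sets lebesgue"
proof (intro conjI allI)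
  have null: "negligible (- (PC :: (real^'n^'m) set))"
    by (rule negligible_Compl_PC[OF assms])
  then show "UNIV - (PC :: (real^'n^'m) set) \<in> null_sets lebesgue"
    unfolding negligible_iff_null_sets Compl_eq_Diff_UNIV .
  from null show "closure (PC :: (real^'n^'m) set) = UNIV"
    by (rule closure_eq_UNIV_if_negligible_Compl)
qed (rule preserves_Chebyshev_iff_alternance_free[OF assms] open_PC[OF assms])+

end
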